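(* There is a polynomial-time algorithm that, given a connected graph $G$, outputs a simultaneous dominating set of $G$ whose size is at most twice the minimum size of a simultaneous dominating set of $G$.
   Context: All graphs are finite, simple and undirected. For a connected graph $G$, a subset $S\subseteq V(G)$ is a simultaneous dominating set of $G$ if $S$ is a dominating set (every vertex not in $S$ has a neighbour in $S$) in every spanning tree of $G$. *)

theory Defs
  imports "HOL-Computational_Algebra.Polynomial"
begin

section \<open>Simultaneous domination\<close>

text \<open>
  A graph is given by its vertex set and its set of two-element edges.  The notions of forest and
  spanning tree in the AFP entry Graph-Theory are not used: there a forest has no directed cycle,
  so an acyclic orientation of a triangle would be a tree.
\<close>

definition simple_graph :: "'a set \<Rightarrow> 'a set set \<Rightarrow> bool" where
  "simple_graph V E \<longleftrightarrow> finite V \<and> (\<forall>e\<in>E. \<exists>u\<in>V. \<exists>v\<in>V. u \<noteq> v \<and> e = {u, v})"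

definition connected_graph :: "'a set \<Rightarrow> 'a set set \<Rightarrow> bool" where
  "connected_graph V E \<longleftrightarrow>
     simple_graph V E \<and> V \<noteq> {} \<and> (\<forall>u\<in>V. \<forall>v\<in>V. (u, v) \<in> {(x, y). {x, y} \<in> E}\<^sup>*)"

definition graph_cycle :: "'a set set \<Rightarrow> 'a list \<Rightarrow> bool" where
  "graph_cycle E p \<longleftrightarrow>
     3 \<le> length p \<and> distinct p \<and> (\<forall>i<length p. {p ! i, p ! (Suc i mod length p)} \<in> E)"

definition tree_graph :: "'a set \<Rightarrow> 'a set set \<Rightarrow> bool" where
  "tree_graph V T \<longleftrightarrow> connected_graph V T \<and> (\<nexists>p. graph_cycle T p)"

definition spanning_tree_of :: "'a set \<Rightarrow> 'a set set \<Rightarrow> 'a set set \<Rightarrow> bool" where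
  "spanning_tree_of V E T \<longleftrightarrow> T \<subseteq> E \<and> tree_graph V T"

definition dominating_set :: "'a set \<Rightarrow> 'a set set \<Rightarrow> 'a set \<Rightarrow> bool" where
  "dominating_set V E S \<longleftrightarrow> S \<subseteq> V \<and> (\<forall>v\<in>V - S. \<exists>u\<in>S. {u, v} \<in> E)"

definition simultaneous_dominating_set :: "'a set \<Rightarrow> 'a set set \<Rightarrow> 'a set \<Rightarrow> bool" where
  "simultaneous_dominating_set V E S \<longleftrightarrow>
     S \<subseteq> V \<and> (\<forall>T. spanning_tree_of V E T \<longrightarrow> dominating_set V T S)"

definition simultaneous_domination_number :: "'a set \<Rightarrow> 'a set set \<Rightarrow> nat" where
  "simultaneous_domination_number V E = Min (card ` {S. simultaneous_dominating_set V E S})"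

lemma finite_simultaneous_dominating_sets:
  "finite V \<Longrightarrow> finite {S. simultaneous_dominating_set V E S}"
  by (rule finite_subset[of _ "Pow V"]) (auto simp: simultaneous_dominating_set_def)

lemma simultaneous_dominating_set_verts: "simultaneous_dominating_set V E V"
  by (simp add: simultaneous_dominating_set_def dominating_set_def)

section \<open>Random access machine programs\<close>

text \<open>
  The machine has named registers (the first component of a state) and an indirectly addressable
  memory (the second component), both holding natural numbers.  Every evaluated node of an
  expression and every executed command or loop test costs one unit.  The only arithmetic
  operations are addition and truncated subtraction, so numbers computed in t steps have O(t) bits
  more than the numbers in the initial state; hence polynomial time in this uniform cost model is
  polynomial time on Turing machines.  (That would fail with unit-cost multiplication.)
\<close>

type_synonym state = "(nat \<Rightarrow> nat) \<times> (nat \<Rightarrow> nat)"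

datatype aexp =
    Const nat
  | Reg nat
  | Mem aexp
  | Plus aexp aexp
  | Minus aexp aexp

fun aval :: "aexp \<Rightarrow> state \<Rightarrow> nat" where
  "aval (Const k) s = k"
| "aval (Reg x) s = fst s x"
| "aval (Mem a) s = snd s (aval a s)"
| "aval (Plus a b) s = aval a s + aval b s"
| "aval (Minus a b) s = aval a s - aval b s"

fun acost :: "aexp \<Rightarrow> nat" where
  "acost (Const k) = 1"
| "acost (Reg x) = 1"
| "acost (Mem a) = 1 + acost a"
| "acost (Plus a b) = 1 + acost a + acost b"
| "acost (Minus a b) = 1 + acost a + acost b"

datatype com =
    Skip
  | Assign nat aexp
  | Store aexp aexp
  | Seq com com
  | If aexp com com
  | While aexp com

text \<open>\<open>exec c s t s'\<close>: started in \<open>s\<close>, the program \<open>c\<close> halts in \<open>s'\<close> after exactly \<open>t\<close> time units.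
  Conditions hold iff their value is nonzero.\<close>

inductive exec :: "com \<Rightarrow> state \<Rightarrow> nat \<Rightarrow> state \<Rightarrow> bool" where
  exec_Skip: "exec Skip s 1 s"
| exec_Assign: "exec (Assign x a) s (1 + acost a) ((fst s)(x := aval a s), snd s)"
| exec_Store: "exec (Store a b) s (1 + acost a + acost b) (fst s, (snd s)(aval a s := aval b s))"
| exec_Seq: "exec c1 s1 t1 s2 \<Longrightarrow> exec c2 s2 t2 s3 \<Longrightarrow> exec (Seq c1 c2) s1 (1 + t1 + t2) s3"
| exec_IfTrue: "aval a s \<noteq> 0 \<Longrightarrow> exec c1 s t s' \<Longrightarrow> exec (If a c1 c2) s (1 + acost a + t) s'"
| exec_IfFalse: "aval a s = 0 \<Longrightarrow> exec c2 s t s' \<Longrightarrow> exec (If a c1 c2) s (1 + acost a + t) s'"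
| exec_WhileFalse: "aval a s = 0 \<Longrightarrow> exec (While a c) s (1 + acost a) s"
| exec_WhileTrue: "aval a s1 \<noteq> 0 \<Longrightarrow> exec c s1 t1 s2 \<Longrightarrow> exec (While a c) s2 t2 s3 \<Longrightarrow>
    exec (While a c) s1 (1 + acost a + t1 + t2) s3"

inductive_cases exec_SkipE: "exec Skip s t s'"
inductive_cases exec_AssignE: "exec (Assign x a) s t s'"
inductive_cases exec_StoreE: "exec (Store a b) s t s'"
inductive_cases exec_SeqE: "exec (Seq c1 c2) s t s'"
inductive_cases exec_IfE: "exec (If a c1 c2) s t s'"
inductive_cases exec_WhileE: "exec (While a c) s t s'"

lemma exec_deterministic:
  "exec c s t s' \<Longrightarrow> exec c s u s'' \<Longrightarrow> t = u \<and> s' = s''"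
proof (induction arbitrary: u s'' rule: exec.induct)
  case (exec_Seq c1 s1 t1 s2 c2 t2 s3)
  from exec_Seq.prems obtain u1 r u2 where
    "u = 1 + u1 + u2" "exec c1 s1 u1 r" "exec c2 r u2 s''"
    by (auto elim: exec_SeqE)
  with exec_Seq.IH show ?case by metis
next
  case (exec_IfTrue a s c1 t s' c2)
  from exec_IfTrue.prems exec_IfTrue.hyps(1) obtain u1 where
    "u = 1 + acost a + u1" "exec c1 s u1 s''"
    by (auto elim: exec_IfE)
  with exec_IfTrue.IH show ?case by metis
next
  case (exec_IfFalse a s c2 t s' c1)
  from exec_IfFalse.prems exec_IfFalse.hyps(1) obtain u1 where
    "u = 1 + acost a + u1" "exec c2 s u1 s''"
    by (auto elim: exec_IfE)
  with exec_IfFalse.IH show ?case by metis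
next
  case (exec_WhileFalse a s c)
  from exec_WhileFalse.prems show ?case
    by (rule exec_WhileE) (use exec_WhileFalse.hyps in simp_all)
next
  case (exec_WhileTrue a s1 c t1 s2 t2 s3)
  from exec_WhileTrue.prems obtain u1 r u2 where
    "u = 1 + acost a + u1 + u2" "exec c s1 u1 r" "exec (While a c) r u2 s''"
    by (rule exec_WhileE) (use exec_WhileTrue.hyps(1) in simp_all)
  with exec_WhileTrue.IH show ?case by metis
next
  case (exec_Skip s)
  then show ?case by (rule exec_SkipE) simp
next
  case (exec_Assign x a s)
  then show ?case by (rule exec_AssignE) simp
next
  case (exec_Store a b s)
  then show ?case by (rule exec_StoreE) simp
qed

text \<open>
  A graph with vertex set \<open>{..<n}\<close> is presented as \<open>n\<close> in register 0 and the adjacency matrix, row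
  by row, in memory cells \<open>0, \<dots>, n * n - 1\<close>; everything else is 0.  The resulting vertex set is
  read off as a bit vector from the \<open>n\<close> memory cells following the matrix.
\<close>

definition graph_input :: "nat \<Rightarrow> nat set set \<Rightarrow> state" where
  "graph_input n E =
     ((\<lambda>_. 0)(0 := n),
      \<lambda>a. if a < n * n \<and> {a div n, a mod n} \<in> E then 1 else 0)"

definition vertex_set_output :: "nat \<Rightarrow> state \<Rightarrow> nat set" where
  "vertex_set_output n s = {v. v < n \<and> snd s (n * n + v) \<noteq> 0}"

end

theory Submission
  imports Defs
begin

text \<open>
  A vertex \<open>v\<close> outside \<open>S\<close> is dominated in every spanning tree iff deleting the edges between \<open>v\<close>
  and \<open>S\<close> disconnects the graph, i.e. iff \<open>S\<close> contains all neighbours of \<open>v\<close> in some component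
  of \<open>G - v\<close>.  Fix a root \<open>r\<close> and let \<open>D(v)\<close> be the set of vertices that \<open>v\<close> separates from \<open>r\<close>.
  Treat the vertices in order of increasing \<open>|D(v)|\<close>, so that \<open>D(v)\<close> is treated before \<open>v\<close>.  If
  \<open>v\<close> is neither in \<open>S\<close> nor dominated in this sense, every component of \<open>G - v\<close> contains a
  neighbour of \<open>v\<close> outside \<open>S\<close>; add \<open>v\<close> to \<open>S\<close> together with such a neighbour \<open>x\<close> in the component
  of \<open>r\<close> (only \<open>v\<close> if \<open>v = r\<close>).  An optimal solution that avoids \<open>v\<close> and \<open>x\<close> must contain all
  neighbours of \<open>v\<close> in some component inside \<open>D(v)\<close>, one of which is outside \<open>S\<close>.  So each addition
  of at most two vertices can be charged to a vertex of the optimal solution, and no vertex is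
  charged twice: a vertex in \<open>D(d)\<close> has all its neighbours in \<open>D(d)\<close> or equal to \<open>d\<close>, hence all of
  them are treated once \<open>d\<close> is.
\<close>

section \<open>Separation and spanning trees\<close>

text \<open>On the vertices, the classes of the reflexive transitive closure are the components of G
  - v, with \<open>v\<close> as a further class of its own.\<close>

definition adj_minus :: "'a set set \<Rightarrow> 'a \<Rightarrow> ('a \<times> 'a) set" where
  "adj_minus E v = {(x, y). {x, y} \<in> E \<and> x \<noteq> v \<and> y \<noteq> v}"

text \<open>This is D(v). From \<open>r = v\<close> only \<open>r\<close> itself is reachable, so
  the root separates all other vertices and is treated last.\<close>

definition separated :: "'a set \<Rightarrow> 'a set set \<Rightarrow> 'a \<Rightarrow> 'a \<Rightarrow> 'a set" where
  "separated V E r v = {x \<in> V. x \<noteq> v \<and> (r, x) \<notin> (adj_minus E v)\<^sup>*}"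

text \<open>A component of G - v is named by a neighbour \<open>w\<close> of \<open>v\<close> in it.
  A vertex without neighbours is never covered, which is right for the one-vertex graph: its vertex
  has to be chosen.\<close>

definition locally_covered :: "'a set set \<Rightarrow> 'a set \<Rightarrow> 'a \<Rightarrow> bool" where
  "locally_covered E S v \<longleftrightarrow>
     (\<exists>w. {v, w} \<in> E \<and> (\<forall>u. {v, u} \<in> E \<longrightarrow> (u, w) \<in> (adj_minus E v)\<^sup>* \<longrightarrow> u \<in> S))"

lemma sym_adj_minus: "sym (adj_minus E v)"
  by (auto simp: sym_def adj_minus_def insert_commute)

lemma adj_minus_rtrancl_sym:
  "(x, y) \<in> (adj_minus E v)\<^sup>* \<Longrightarrow> (y, x) \<in> (adj_minus E v)\<^sup>*"
  using sym_adj_minus by (metis sym_def sym_rtrancl)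

lemma adj_minus_rtrancl_neq:
  "(x, y) \<in> (adj_minus E v)\<^sup>* \<Longrightarrow> x \<noteq> v \<Longrightarrow> y \<noteq> v"
  by (induction rule: rtrancl_induct) (auto simp: adj_minus_def)

text \<open>Cut the walk at its first visit to \<open>v\<close>; the vertex just before is
  \<open>u\<close>. Hence in a connected graph every component left by deleting \<open>v\<close>
  contains a neighbour of \<open>v\<close>.\<close>

lemma adj_minus_last_step:
  assumes "(x, v) \<in> {(x, y). {x, y} \<in> F}\<^sup>*" "x \<noteq> v"
  obtains u where "{v, u} \<in> F" "(x, u) \<in> (adj_minus F v)\<^sup>*"
proof -
  have "\<exists>u. {v, u} \<in> F \<and> (x, u) \<in> (adj_minus F v)\<^sup>*"
    using assms
  proof (induction rule: converse_rtrancl_induct)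
    case (step x y)
    show ?case
    proof (cases "y = v")
      case True
      with step show ?thesis by (auto simp: insert_commute)
    next
      case False
      with step obtain u where "{v, u} \<in> F" "(y, u) \<in> (adj_minus F v)\<^sup>*" by blast
      moreover have "(x, y) \<in> adj_minus F v"
        using step False by (auto simp: adj_minus_def)
      ultimately show ?thesis by (meson converse_rtrancl_into_rtrancl)
    qed
  qed auto
  then show ?thesis using that by blast
qed

section \<open>Domination in all spanning trees as a local condition\<close>

lemma adj_minus_mono: "F \<subseteq> E \<Longrightarrow> adj_minus F v \<subseteq> adj_minus E v"
  by (auto simp: adj_minus_def)

lemma simple_graph_edgeD:
  assumes "simple_graph V E" "{u, v} \<in> E"
  shows "u \<in> V" "v \<in> V" "u \<noteq> v"
proof -
  obtain x y where "x \<in> V" "y \<in> V" "x \<noteq> y" "{u, v} = {x, y}"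
    using assms unfolding simple_graph_def by metis
  then show "u \<in> V" "v \<in> V" "u \<noteq> v"
    by (auto simp: doubleton_eq_iff)
qed

lemma connected_graph_simple: "connected_graph V E \<Longrightarrow> simple_graph V E"
  by (simp add: connected_graph_def)

text \<open>The walk in \<open>T\<close> from \<open>w\<close> to \<open>v\<close> first enters
  \<open>v\<close> from some \<open>u\<close>. Until then it avoids \<open>v\<close>, so
  \<open>u\<close> is a neighbour of \<open>v\<close> in the covered component of
  \<open>w\<close>.\<close>

lemma locally_covered_imp_dominated:
  assumes "connected_graph V E" "spanning_tree_of V E T" "locally_covered E S v" "v \<in> V"
  shows "\<exists>u\<in>S. {u, v} \<in> T"
proof -
  obtain w where w: "{v, w} \<in> E"
      "\<And>u. {v, u} \<in> E \<Longrightarrow> (u, w) \<in> (adj_minus E v)\<^sup>* \<Longrightarrow> u \<in> S"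
    using assms(3) unfolding locally_covered_def by blast
  have T: "T \<subseteq> E" "connected_graph V T"
    using assms(2) by (auto simp: spanning_tree_of_def tree_graph_def)
  have "w \<in> V" "w \<noteq> v"
    using simple_graph_edgeD[OF connected_graph_simple[OF assms(1)] w(1)] by auto
  then obtain u where u: "{v, u} \<in> T" "(w, u) \<in> (adj_minus T v)\<^sup>*"
    using T(2) assms(4) adj_minus_last_step[of w v T] unfolding connected_graph_def by metis
  then have "(w, u) \<in> (adj_minus E v)\<^sup>*"
    using rtrancl_mono[OF adj_minus_mono[OF T(1)]] by blast
  then have "u \<in> S"
    using w(2)[OF _ adj_minus_rtrancl_sym] u(1) T(1) by auto
  with u show ?thesis by (auto simp: insert_commute)
qed

text \<open>The rest of the cycle, followed from \<open>p ! 1\<close> round to \<open>p ! 0\<close>,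
  replaces the deleted edge.\<close>

lemma connected_graph_delete_cycle_edge:
  assumes "connected_graph V T" "graph_cycle T p"
  shows "connected_graph V (T - {{p ! 0, p ! 1}})"
proof -
  let ?e = "{p ! 0, p ! 1}"
  let ?R = "{(x, y). {x, y} \<in> T - {?e}}"
  have len: "3 \<le> length p" and dist: "distinct p"
    and cyc: "\<And>i. i < length p \<Longrightarrow> {p ! i, p ! (Suc i mod length p)} \<in> T"
    using assms(2) by (auto simp: graph_cycle_def)
  have cyc_step: "(p ! i, p ! (Suc i mod length p)) \<in> ?R" if "1 \<le> i" "i < length p" for i
  proof -
    have eq: "p ! j = p ! k \<longleftrightarrow> j = k" if "j < length p" "k < length p" for j k
      using nth_eq_iff_index_eq[OF dist that] .
    have m: "Suc i mod length p < length p" using len by (intro mod_less_divisor) linarith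
    \<comment> \<open>The edge at \<open>i = 1\<close> could be \<open>?e\<close> backwards only if
      its second end were \<open>p ! 0\<close>, as in a cycle of length 2.\<close>
    have "i = 1 \<Longrightarrow> Suc i mod length p = 2" using len by simp
    then have "\<not> (i = 1 \<and> Suc i mod length p = 0)" by auto
    moreover have "p ! i \<noteq> p ! 0" using that len by (subst eq) auto
    moreover have "p ! i = p ! 1 \<longleftrightarrow> i = 1" using that len by (intro eq) auto
    moreover have "p ! (Suc i mod length p) = p ! 0 \<longleftrightarrow> Suc i mod length p = 0"
      using m len by (intro eq) auto
    ultimately have "{p ! i, p ! (Suc i mod length p)} \<noteq> ?e"
      unfolding doubleton_eq_iff by metis
    then show ?thesis using cyc[OF that(2)] by simp
  qed
  have path: "(p ! 1, p ! i) \<in> ?R\<^sup>*" if "1 \<le> i" "i < length p" for i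
    using that
  proof (induction i rule: dec_induct)
    case (step i)
    then have "(p ! i, p ! Suc i) \<in> ?R" using cyc_step[of i] by simp
    with step show ?case by (metis (no_types, lifting) Suc_lessD rtrancl.rtrancl_into_rtrancl)
  qed auto
  have "(p ! (length p - 1), p ! 0) \<in> ?R"
  proof -
    have "Suc (length p - 1) = length p" using len by linarith
    then show ?thesis using cyc_step[of "length p - 1"] len by simp
  qed
  moreover have "(p ! 1, p ! (length p - 1)) \<in> ?R\<^sup>*"
    using len by (intro path) linarith+
  ultimately have 10: "(p ! 1, p ! 0) \<in> ?R\<^sup>*" by (rule rtrancl_into_rtrancl[rotated])
  have "sym (?R\<^sup>*)"
    by (rule sym_rtrancl) (auto simp: sym_def insert_commute)
  then have 01: "(p ! 0, p ! 1) \<in> ?R\<^sup>*" using 10 by (meson symD)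
  have sub: "{(x, y). {x, y} \<in> T} \<subseteq> ?R\<^sup>*"
  proof clarify
    fix x y assume "{x, y} \<in> T"
    then show "(x, y) \<in> ?R\<^sup>*"
      using 10 01 by (cases "{x, y} = ?e") (auto simp: doubleton_eq_iff)
  qed
  have "(u, v) \<in> ?R\<^sup>*" if "u \<in> V" "v \<in> V" for u v
    using assms(1) that rtrancl_subset_rtrancl[OF sub] unfolding connected_graph_def by blast
  then show ?thesis
    using assms(1) unfolding connected_graph_def simple_graph_def by auto
qed

text \<open>Delete an edge of a cycle as long as there is one; finiteness of the edge set ends
  this.\<close>

lemma connected_graph_has_spanning_tree:
  assumes "connected_graph V E"
  obtains T where "spanning_tree_of V E T"
proof -
  have "E \<subseteq> Pow V"
    using assms unfolding connected_graph_def simple_graph_def by fastforce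
  then have fin: "finite E"
    using assms finite_subset unfolding connected_graph_def simple_graph_def by blast
  have "\<exists>T. spanning_tree_of V E T"
    using fin assms
  proof (induction E rule: finite_psubset_induct)
    case (psubset E)
    show ?case
    proof (cases "\<exists>p. graph_cycle E p")
      case False
      with psubset.prems show ?thesis by (auto simp: spanning_tree_of_def tree_graph_def)
    next
      case True
      then obtain p where p: "graph_cycle E p" by blast
      then have "3 \<le> length p" "\<forall>i<length p. {p ! i, p ! (Suc i mod length p)} \<in> E"
        unfolding graph_cycle_def by auto
      then have "{p ! 0, p ! 1} \<in> E" by (auto dest: spec[of _ 0])
      then have "E - {{p ! 0, p ! 1}} \<subset> E" by blast
      from psubset.IH[OF this connected_graph_delete_cycle_edge[OF psubset.prems p]]
      show ?thesis unfolding spanning_tree_of_def by blast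
    qed
  qed
  then show ?thesis using that by blast
qed

text \<open>If every component of G - v has a neighbour of \<open>v\<close> outside
  \<open>S\<close>, deleting all edges between \<open>v\<close> and \<open>S\<close> leaves a
  connected graph \<open>F\<close>. A spanning tree of \<open>F\<close> is one of the whole graph
  and does not dominate \<open>v\<close>.\<close>

lemma simultaneous_dominating_set_locally_covered:
  assumes conn: "connected_graph V E" and S: "simultaneous_dominating_set V E S"
    and v: "v \<in> V" "v \<notin> S"
  shows "locally_covered E S v"
proof (rule ccontr)
  assume nc: "\<not> locally_covered E S v"
  define F where "F = {e \<in> E. \<not> (\<exists>u\<in>S. e = {u, v})}"
  let ?R = "{(x, y). {x, y} \<in> F}"
  have sub: "adj_minus E v \<subseteq> ?R"
    by (auto simp: adj_minus_def F_def doubleton_eq_iff)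
  have to_v: "(z, v) \<in> ?R\<^sup>*" if z: "z \<in> V" for z
  proof (cases "z = v")
    case False
    then obtain w where w: "{v, w} \<in> E" "(z, w) \<in> (adj_minus E v)\<^sup>*"
      using conn z v(1) adj_minus_last_step[of z v E] unfolding connected_graph_def by metis
    obtain u where u: "{v, u} \<in> E" "(u, w) \<in> (adj_minus E v)\<^sup>*" "u \<notin> S"
      using nc w(1) unfolding locally_covered_def by blast
    have "(z, u) \<in> (adj_minus E v)\<^sup>*"
      using w(2) adj_minus_rtrancl_sym[OF u(2)] by (rule rtrancl_trans)
    then have "(z, u) \<in> ?R\<^sup>*" using rtrancl_mono[OF sub] by blast
    moreover have "(u, v) \<in> ?R"
      using u v by (auto simp: F_def insert_commute doubleton_eq_iff)
    ultimately show ?thesis by (rule rtrancl_into_rtrancl)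
  qed simp
  have "sym (?R\<^sup>*)" by (rule sym_rtrancl) (auto simp: sym_def insert_commute)
  then have "(x, y) \<in> ?R\<^sup>*" if "x \<in> V" "y \<in> V" for x y
    using to_v[OF that(1)] to_v[OF that(2)] by (meson rtrancl_trans symD)
  then have "connected_graph V F"
    using conn unfolding connected_graph_def simple_graph_def F_def by auto
  then obtain T where T: "spanning_tree_of V F T"
    using connected_graph_has_spanning_tree by blast
  then have "spanning_tree_of V E T" unfolding spanning_tree_of_def F_def by blast
  then obtain u where "u \<in> S" "{u, v} \<in> T"
    using S v unfolding simultaneous_dominating_set_def dominating_set_def by blast
  then show False using T unfolding spanning_tree_of_def F_def by blast
qed

lemma simultaneous_dominating_set_iff:
  assumes "connected_graph V E"
  shows "simultaneous_dominating_set V E S \<longleftrightarrow>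
    S \<subseteq> V \<and> (\<forall>v\<in>V - S. locally_covered E S v)"
  using simultaneous_dominating_set_locally_covered[OF assms]
    locally_covered_imp_dominated[OF assms]
  unfolding simultaneous_dominating_set_def dominating_set_def by blast

text \<open>This makes the order by size work: everything in D(d) has a smaller separated set than
  \<open>d\<close> and so is treated earlier. What \<open>r\<close> reaches without passing
  \<open>d\<close> it also reaches without passing \<open>c\<close>, and likewise \<open>d\<close>
  itself; complements give the inclusion.\<close>

lemma separated_psubset:
  assumes conn: "connected_graph V E" and r: "r \<in> V" and c: "c \<in> separated V E r d"
  shows "separated V E r c \<subset> separated V E r d"
proof -
  have cV: "c \<in> V" and cd: "c \<noteq> d" and ncr: "(r, c) \<notin> (adj_minus E d)\<^sup>*"
    using c by (auto simp: separated_def)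
  have rc: "r \<noteq> c" using ncr by auto
  have avoid_d: "(r, x) \<in> (adj_minus E d)\<^sup>*"
    if "(r, x) \<in> (adj_minus E c)\<^sup>*" "(r, d) \<notin> (adj_minus E c)\<^sup>*" for x
    using that
  proof (induction rule: rtrancl_induct)
    case (step y z)
    then have "y \<noteq> d" "z \<noteq> d" by (auto dest: rtrancl_into_rtrancl)
    then have "(y, z) \<in> adj_minus E d" using step by (auto simp: adj_minus_def)
    with step show ?case by (meson rtrancl_into_rtrancl)
  qed simp
  \<comment> \<open>Otherwise a walk from \<open>r\<close>, cut at its first arrival at
    \<open>c\<close>, would avoid \<open>d\<close>, and \<open>d\<close> would not separate
    \<open>c\<close> from \<open>r\<close>.\<close>
  have rd: "(r, d) \<in> (adj_minus E c)\<^sup>*"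
  proof (rule ccontr)
    assume nd: "(r, d) \<notin> (adj_minus E c)\<^sup>*"
    obtain z where z: "{c, z} \<in> E" "(r, z) \<in> (adj_minus E c)\<^sup>*"
      using conn r cV rc adj_minus_last_step[of r c E] unfolding connected_graph_def by metis
    then have "z \<noteq> d" using nd by auto
    then have "(z, c) \<in> adj_minus E d" using z cd by (auto simp: adj_minus_def insert_commute)
    then show False using avoid_d[OF z(2) nd] ncr by (meson rtrancl_into_rtrancl)
  qed
  have avoid_c: "(r, x) \<in> (adj_minus E c)\<^sup>*" if "(r, x) \<in> (adj_minus E d)\<^sup>*" for x
    using that
  proof (induction rule: rtrancl_induct)
    case (step y z)
    then have "y \<noteq> c" "z \<noteq> c" using ncr by (auto dest: rtrancl_into_rtrancl)
    then have "(y, z) \<in> adj_minus E c" using step by (auto simp: adj_minus_def)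
    with step show ?case by (meson rtrancl_into_rtrancl)
  qed simp
  have "separated V E r c \<subseteq> separated V E r d"
    using rd avoid_c by (auto simp: separated_def)
  moreover have "c \<notin> separated V E r c" by (simp add: separated_def)
  ultimately show ?thesis using c by blast
qed

text \<open>D(d) is a union of components of G - d, so an edge can leave it only towards
  \<open>d\<close>.\<close>

lemma separated_neighbour:
  assumes "simple_graph V E" "x \<in> separated V E r d" "{c, x} \<in> E" "c \<noteq> d"
  shows "c \<in> separated V E r d"
proof -
  have "(c, x) \<in> adj_minus E d"
    using assms by (auto simp: separated_def adj_minus_def)
  then have "(r, c) \<notin> (adj_minus E d)\<^sup>*"
    using assms(2) by (auto simp: separated_def dest: rtrancl_into_rtrancl)
  then show ?thesis
    using simple_graph_edgeD[OF assms(1,3)] assms(4) by (simp add: separated_def)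
qed

section \<open>The charging argument\<close>

text \<open>\<open>P\<close> holds the treated vertices and \<open>Q\<close> the vertices of a
  solution \<open>X\<close> charged so far, each paying for two vertices of \<open>S\<close>. All
  \<open>X\<close> are followed at once, since the algorithm knows no optimal one. The restriction
  on where \<open>Q\<close> may lie is what later shows a charge to be new.\<close>

definition greedy_invariant :: "'a set \<Rightarrow> 'a set set \<Rightarrow> 'a \<Rightarrow> 'a set \<Rightarrow> 'a set \<Rightarrow> bool" where
  "greedy_invariant V E r P S \<longleftrightarrow> S \<subseteq> V \<and> (\<forall>v\<in>P. v \<in> S \<or> locally_covered E S v) \<and>
     (\<forall>X. simultaneous_dominating_set V E X \<longrightarrow>
        (\<exists>Q\<subseteq>X. card S \<le> 2 * card Q \<and> Q \<subseteq> S \<union> (\<Union>c\<in>P. separated V E r c)))"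

lemma greedy_invariant_empty: "greedy_invariant V E r {} {}"
  by (auto simp: greedy_invariant_def)

lemma locally_covered_mono: "locally_covered E S v \<Longrightarrow> S \<subseteq> S' \<Longrightarrow> locally_covered E S' v"
  unfolding locally_covered_def by blast

lemma greedy_invariant_skip:
  assumes "greedy_invariant V E r P S" "c \<in> S \<or> locally_covered E S c"
  shows "greedy_invariant V E r (insert c P) S"
proof -
  have "S \<union> (\<Union>c\<in>P. separated V E r c) \<subseteq> S \<union> (\<Union>c\<in>insert c P. separated V E r c)" by blast
  with assms show ?thesis unfolding greedy_invariant_def
    by (metis (no_types, lifting) insert_iff subset_trans)
qed

text \<open>The choice \<open>x = c\<close> encodes that no partner exists. The hypothesis
  \<open>closed\<close> is all that is used of the order of treatment.\<close>

lemma greedy_invariant_add: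
  assumes inv: "greedy_invariant V E r P S" and conn: "connected_graph V E" and r: "r \<in> V"
    and c: "c \<in> V" "c \<notin> P" "c \<notin> S" "\<not> locally_covered E S c"
    and closed: "\<And>d. d \<in> P \<Longrightarrow> separated V E r d \<subseteq> P"
    and x: "x = c \<or> {c, x} \<in> E \<and> (r, x) \<in> (adj_minus E c)\<^sup>* \<and> x \<notin> S"
    and x_eq: "x = c \<Longrightarrow> \<not> (\<exists>y. {c, y} \<in> E \<and> (r, y) \<in> (adj_minus E c)\<^sup>* \<and> y \<notin> S)"
  shows "greedy_invariant V E r (insert c P) (insert x (insert c S))"
proof -
  let ?S = "insert x (insert c S)"
  have sg: "simple_graph V E" using conn by (rule connected_graph_simple)
  have xV: "x \<in> V" using x c simple_graph_edgeD[OF sg] by blast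
  have finV: "finite V" using sg by (simp add: simple_graph_def)
  have finS: "finite S" using inv finV finite_subset unfolding greedy_invariant_def by blast
  have "card ?S \<le> card (insert c S) + 1"
    using finS by (simp add: card_insert_if)
  also have "\<dots> \<le> card S + 2"
    using finS by (simp add: card_insert_if)
  finally have cardS: "card ?S \<le> card S + 2" .
  \<comment> \<open>For \<open>c\<close> other than the root, the component of \<open>r\<close> in G
    - c contains a neighbour of \<open>c\<close>, and even one outside \<open>S\<close> because
    \<open>c\<close> is not locally covered. So only the root can lack a partner.\<close>
  have x_root: "x = c \<Longrightarrow> c = r"
  proof (rule ccontr)
    assume "x = c" "c \<noteq> r"
    then obtain w where w: "{c, w} \<in> E" "(r, w) \<in> (adj_minus E c)\<^sup>*"
      using conn r c adj_minus_last_step[of r c E] unfolding connected_graph_def by metis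
    then obtain u where u: "{c, u} \<in> E" "(u, w) \<in> (adj_minus E c)\<^sup>*" "u \<notin> S"
      using c(4) unfolding locally_covered_def by blast
    show False
      using x_eq[OF \<open>x = c\<close>] u rtrancl_trans[OF w(2) adj_minus_rtrancl_sym[OF u(2)]] by blast
  qed
  have "\<exists>Q\<subseteq>X. card ?S \<le> 2 * card Q \<and>
      Q \<subseteq> ?S \<union> (\<Union>c\<in>insert c P. separated V E r c)"
    if X: "simultaneous_dominating_set V E X" for X
  proof -
    obtain Q where Q: "Q \<subseteq> X" "card S \<le> 2 * card Q"
        "Q \<subseteq> S \<union> (\<Union>c\<in>P. separated V E r c)"
      using inv X unfolding greedy_invariant_def by blast
    have "finite X" using X finV finite_subset unfolding simultaneous_dominating_set_def by blast
    then have finQ: "finite Q" using Q finite_subset by blast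
    \<comment> \<open>As \<open>y\<close> is outside \<open>S\<close>, an earlier charge puts it
      into D(d) for a treated \<open>d\<close>. Then \<open>c\<close> is \<open>d\<close> or lies in
      D(d), so it would have been treated already.\<close>
    have fresh: "y \<notin> Q" if y: "y = c \<or> {c, y} \<in> E" "y \<notin> S" for y
    proof
      assume "y \<in> Q"
      then obtain d where d: "d \<in> P" "y \<in> separated V E r d" using Q y by blast
      then have "c \<noteq> d" "c \<notin> separated V E r d" using c closed by blast+
      then show False using y(1) d(2) separated_neighbour[OF sg d(2)] by blast
    qed
    \<comment> \<open>The vertex to charge is \<open>c\<close> or \<open>x\<close> if
      \<open>X\<close> contains one of them, and otherwise a neighbour of \<open>c\<close> outside
      \<open>S\<close> in the component of G - c that \<open>X\<close> covers.\<close>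
    have "\<exists>y\<in>X. (y = c \<or> {c, y} \<in> E) \<and> y \<notin> S \<and> y \<in> ?S \<union> separated V E r c"
    proof (cases "c \<in> X \<or> x \<in> X")
      case True
      then show ?thesis using c x by blast
    next
      case False
      then have "locally_covered E X c"
        using X c simultaneous_dominating_set_iff[OF conn] by blast
      then obtain w where w: "{c, w} \<in> E"
          "\<And>u. {c, u} \<in> E \<Longrightarrow> (u, w) \<in> (adj_minus E c)\<^sup>* \<Longrightarrow> u \<in> X"
        unfolding locally_covered_def by blast
      then obtain u where u: "{c, u} \<in> E" "(u, w) \<in> (adj_minus E c)\<^sup>*" "u \<notin> S"
        using c(4) unfolding locally_covered_def by blast
      have uc: "u \<noteq> c" "u \<in> V" using simple_graph_edgeD[OF sg u(1)] by auto
      \<comment> \<open>If the component covered by \<open>X\<close> were that of \<open>r\<close>,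
        then \<open>X\<close> would contain the partner \<open>x\<close>. Without a partner
        \<open>c\<close> is the root, from which nothing else is reachable in G - c.\<close>
      have "(r, u) \<notin> (adj_minus E c)\<^sup>*"
      proof
        assume ru: "(r, u) \<in> (adj_minus E c)\<^sup>*"
        show False
        proof (cases "x = c")
          case True
          then show False
            using x_root uc adj_minus_rtrancl_neq[OF adj_minus_rtrancl_sym[OF ru]] by simp
        next
          case False
          then have "{c, x} \<in> E" "(r, x) \<in> (adj_minus E c)\<^sup>*" using x by auto
          then have "(x, w) \<in> (adj_minus E c)\<^sup>*"
            using rtrancl_trans[OF rtrancl_trans[OF adj_minus_rtrancl_sym ru] u(2)] by blast
          then show False using w(2) \<open>{c, x} \<in> E\<close> \<open>\<not> (c \<in> X \<or> x \<in> X)\<close> by blast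
        qed
      qed
      then have "u \<in> separated V E r c" using uc by (simp add: separated_def)
      then show ?thesis using u w by blast
    qed
    then obtain y where y: "y \<in> X" "y = c \<or> {c, y} \<in> E" "y \<notin> S"
        "y \<in> ?S \<union> separated V E r c" by blast
    have "card ?S \<le> 2 * card (insert y Q)"
      using cardS Q(2) fresh[OF y(2,3)] finQ by simp
    moreover have "insert y Q \<subseteq> X" using y Q by blast
    moreover have "insert y Q \<subseteq> ?S \<union> (\<Union>c\<in>insert c P. separated V E r c)"
      using y(4) Q(3) by blast
    ultimately show ?thesis by blast
  qed
  moreover have "\<forall>v\<in>insert c P. v \<in> ?S \<or> locally_covered E ?S v"
    using inv locally_covered_mono[of E S _ ?S] unfolding greedy_invariant_def by blast
  ultimately show ?thesis
    using inv c(1) xV unfolding greedy_invariant_def by blast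
qed

lemma greedy_invariant_final:
  assumes inv: "greedy_invariant V E r V S" and conn: "connected_graph V E"
  shows "simultaneous_dominating_set V E S"
    and "card S \<le> 2 * simultaneous_domination_number V E"
proof -
  show "simultaneous_dominating_set V E S"
    using inv simultaneous_dominating_set_iff[OF conn] unfolding greedy_invariant_def by blast
  have finV: "finite V" using conn by (simp add: connected_graph_def simple_graph_def)
  have "simultaneous_domination_number V E \<in> card ` {S. simultaneous_dominating_set V E S}"
    unfolding simultaneous_domination_number_def
    using finite_simultaneous_dominating_sets[OF finV] simultaneous_dominating_set_verts
    by (intro Min_in) auto
  then obtain X where X: "simultaneous_dominating_set V E X"
      "card X = simultaneous_domination_number V E" by auto
  then obtain Q where "Q \<subseteq> X" "card S \<le> 2 * card Q"
    using inv unfolding greedy_invariant_def by blast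
  moreover have "finite X"
    using X finV finite_subset unfolding simultaneous_dominating_set_def by blast
  ultimately show "card S \<le> 2 * simultaneous_domination_number V E"
    using X(2) card_mono[of X Q] by linarith
qed

section \<open>Loop programs\<close>

text \<open>The only loop is meant to run its counter from 0 to n - 1, with n in register 0.
  Termination and a time bound can then be read off the syntax.\<close>

datatype lcom =
    LSkip
  | LAssign nat aexp
  | LStore aexp aexp
  | LSeq lcom lcom
  | LIf aexp lcom lcom
  | LFor nat lcom

primrec compile :: "lcom \<Rightarrow> com" where
  "compile LSkip = Skip"
| "compile (LAssign x a) = Assign x a"
| "compile (LStore a b) = Store a b"
| "compile (LSeq c d) = Seq (compile c) (compile d)"
| "compile (LIf a c d) = If a (compile c) (compile d)"
| "compile (LFor i c) = Seq (Assign i (Const 0))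
     (While (Minus (Reg 0) (Reg i)) (Seq (compile c) (Assign i (Plus (Reg i) (Const 1)))))"

definition reg_upd :: "nat \<Rightarrow> nat \<Rightarrow> state \<Rightarrow> state" where
  "reg_upd x k s = ((fst s)(x := k), snd s)"

definition mem_upd :: "nat \<Rightarrow> nat \<Rightarrow> state \<Rightarrow> state" where
  "mem_upd a k s = (fst s, (snd s)(a := k))"

lemma reg_upd_simps [simp]:
  "fst (reg_upd x k s) y = (if y = x then k else fst s y)"
  "snd (reg_upd x k s) = snd s"
  by (simp_all add: reg_upd_def)

lemma mem_upd_simps [simp]:
  "fst (mem_upd a k s) = fst s"
  "snd (mem_upd a k s) b = (if b = a then k else snd s b)"
  by (simp_all add: mem_upd_def)

text \<open>The number of rounds is fixed on entry to a loop. This agrees with the compiled while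
  loop when the body changes neither register 0 nor the counter, hence \<open>written\<close> and
  \<open>counters_protected\<close>.\<close>

primrec run :: "lcom \<Rightarrow> state \<Rightarrow> state" where
  "run LSkip = (\<lambda>s. s)"
| "run (LAssign x a) = (\<lambda>s. reg_upd x (aval a s) s)"
| "run (LStore a b) = (\<lambda>s. mem_upd (aval a s) (aval b s) s)"
| "run (LSeq c d) = (\<lambda>s. run d (run c s))"
| "run (LIf a c d) = (\<lambda>s. if aval a s = 0 then run d s else run c s)"
| "run (LFor i c) = (\<lambda>s.
     ((\<lambda>q. reg_upd i (Suc (fst (run c q) i)) (run c q)) ^^ fst s 0) (reg_upd i 0 s))"

primrec written :: "lcom \<Rightarrow> nat set" where
  "written LSkip = {}"
| "written (LAssign x a) = {x}"
| "written (LStore a b) = {}"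
| "written (LSeq c d) = written c \<union> written d"
| "written (LIf a c d) = written c \<union> written d"
| "written (LFor i c) = insert i (written c)"

primrec counters_protected :: "lcom \<Rightarrow> bool" where
  "counters_protected LSkip = True"
| "counters_protected (LAssign x a) = True"
| "counters_protected (LStore a b) = True"
| "counters_protected (LSeq c d) = (counters_protected c \<and> counters_protected d)"
| "counters_protected (LIf a c d) = (counters_protected c \<and> counters_protected d)"
| "counters_protected (LFor i c) = (counters_protected c \<and> i \<notin> written c)"

text \<open>Both branches of a conditional are added, because a maximum of polynomials need not be
  one. For a loop, 7 is 1 for \<open>Seq\<close>, 2 for the initialisation and 4 for the failing
  test; the 9 of a round is 4 for the test, 1 for \<open>Seq\<close> and 4 for the
  increment.\<close>

primrec time_poly :: "lcom \<Rightarrow> nat poly" where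
  "time_poly LSkip = [:1:]"
| "time_poly (LAssign x a) = [:1 + acost a:]"
| "time_poly (LStore a b) = [:1 + acost a + acost b:]"
| "time_poly (LSeq c d) = [:1:] + time_poly c + time_poly d"
| "time_poly (LIf a c d) = [:1 + acost a:] + time_poly c + time_poly d"
| "time_poly (LFor i c) = [:7:] + [:0, 1:] * (time_poly c + [:9:])"

lemma run_frame: "x \<notin> written c \<Longrightarrow> fst (run c s) x = fst s x"
proof (induction c arbitrary: s)
  case (LFor i c)
  let ?f = "\<lambda>q. reg_upd i (Suc (fst (run c q) i)) (run c q)"
  have "fst ((?f ^^ k) q) x = fst q x" for k q
    using LFor by (induction k) auto
  then show ?case using LFor.prems by simp
qed auto

lemma compile_exec:
  "counters_protected c \<Longrightarrow> 0 \<notin> written c \<Longrightarrow>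
    \<exists>t. exec (compile c) s t (run c s) \<and> t \<le> poly (time_poly c) (fst s 0)"
proof (induction c arbitrary: s)
  case LSkip
  then show ?case using exec_Skip by fastforce
next
  case (LAssign x a)
  then show ?case using exec_Assign[of x a s] by (fastforce simp: reg_upd_def)
next
  case (LStore a b)
  then show ?case using exec_Store[of a b s] by (fastforce simp: mem_upd_def)
next
  case (LSeq c d)
  obtain t where t: "exec (compile c) s t (run c s)" "t \<le> poly (time_poly c) (fst s 0)"
    using LSeq by fastforce
  obtain u where u: "exec (compile d) (run c s) u (run d (run c s))"
      "u \<le> poly (time_poly d) (fst (run c s) 0)"
    using LSeq by fastforce
  have "fst (run c s) 0 = fst s 0" using LSeq.prems by (simp add: run_frame)
  then show ?case using exec_Seq[OF t(1) u(1)] t(2) u(2) by fastforce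
next
  case (LIf a c d)
  obtain t where t: "exec (compile c) s t (run c s)" "t \<le> poly (time_poly c) (fst s 0)"
    using LIf by fastforce
  obtain u where u: "exec (compile d) s u (run d s)" "u \<le> poly (time_poly d) (fst s 0)"
    using LIf by fastforce
  show ?case
  proof (cases "aval a s = 0")
    case True
    then show ?thesis using exec_IfFalse[OF True u(1), of "compile c"] u(2) by fastforce
  next
    case False
    then show ?thesis using exec_IfTrue[OF False t(1), of "compile d"] t(2) by fastforce
  qed
next
  case (LFor i c)
  let ?f = "\<lambda>q. reg_upd i (Suc (fst (run c q) i)) (run c q)"
  let ?b = "Seq (compile c) (Assign i (Plus (Reg i) (Const 1)))"
  let ?a = "Minus (Reg 0) (Reg i)"
  define n where "n = fst s 0"
  define B where "B = poly (time_poly c) n"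
  have prot: "i \<noteq> 0" "i \<notin> written c" "0 \<notin> written c" "counters_protected c"
    using LFor.prems by auto
  \<comment> \<open>\<open>k\<close> counts the rounds still to come, so the induction may start in
    the middle of the loop.\<close>
  have loop: "\<exists>t. exec (While ?a ?b) q t ((?f ^^ k) q) \<and> t \<le> k * (B + 9) + 4"
    if "fst q 0 = n" "fst q i + k = n" for k q
    using that
  proof (induction k arbitrary: q)
    case 0
    then have "exec (While ?a ?b) q (1 + acost ?a) q" by (intro exec_WhileFalse) auto
    then show ?case by fastforce
  next
    case (Suc k)
    obtain t where t: "exec (compile c) q t (run c q)" "t \<le> B"
      using LFor.IH[of q] prot Suc.prems by (auto simp: B_def)
    have body: "exec ?b q (1 + t + 4) (?f q)"
      using exec_Seq[OF t(1) exec_Assign[of i "Plus (Reg i) (Const 1)" "run c q"]]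
      by (simp add: reg_upd_def eval_nat_numeral)
    have "fst (?f q) 0 = n" "fst (?f q) i + k = n"
      using Suc.prems prot by (auto simp: run_frame)
    then obtain u where u: "exec (While ?a ?b) (?f q) u ((?f ^^ k) (?f q))"
        "u \<le> k * (B + 9) + 4"
      using Suc.IH by blast
    have "exec (While ?a ?b) q (1 + acost ?a + (1 + t + 4) + u) ((?f ^^ k) (?f q))"
      using Suc.prems by (intro exec_WhileTrue[OF _ body u(1)]) auto
    moreover have "(?f ^^ k) (?f q) = (?f ^^ Suc k) q"
      by (simp only: funpow_Suc_right o_def)
    moreover have "1 + acost ?a + (1 + t + 4) + u \<le> Suc k * (B + 9) + 4"
      using t(2) u(2) by simp
    ultimately show ?case by (intro exI[of _ "1 + acost ?a + (1 + t + 4) + u"]) simp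
  qed
  have "\<exists>t. exec (While ?a ?b) (reg_upd i 0 s) t
      ((?f ^^ n) (reg_upd i 0 s)) \<and> t \<le> n * (B + 9) + 4"
    using prot by (intro loop) (auto simp: n_def)
  then obtain t where t: "exec (While ?a ?b) (reg_upd i 0 s) t
      ((?f ^^ n) (reg_upd i 0 s))" "t \<le> n * (B + 9) + 4"
    by blast
  have "exec (Assign i (Const 0)) s 2 (reg_upd i 0 s)"
    using exec_Assign[of i "Const 0" s] by (simp add: numeral_2_eq_2 reg_upd_def)
  from exec_Seq[OF this t(1)] show ?case
    using t(2) by (intro exI[of _ "1 + 2 + t"]) (simp add: n_def B_def)
qed

text \<open>The rule itself tracks the counter and register 0. \<open>I\<close> may leave them out,
  but it has to survive the increment of the counter.\<close>

lemma run_LFor_invariant: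
  assumes n: "fst s 0 = n" and prot: "i \<noteq> 0" "i \<notin> written c" "0 \<notin> written c"
    and init: "I 0 (reg_upd i 0 s)"
    and step: "\<And>k q. k < n \<Longrightarrow> fst q i = k \<Longrightarrow> fst q 0 = n \<Longrightarrow> I k q \<Longrightarrow>
      I (Suc k) (reg_upd i (Suc k) (run c q))"
  shows "I n (run (LFor i c) s)"
proof -
  let ?f = "\<lambda>q. reg_upd i (Suc (fst (run c q) i)) (run c q)"
  let ?s = "reg_upd i 0 s"
  have "I k ((?f ^^ k) ?s) \<and> fst ((?f ^^ k) ?s) i = k \<and> fst ((?f ^^ k) ?s) 0 = n" if "k \<le> n" for k
    using that
  proof (induction k)
    case 0
    then show ?case using init n prot by simp
  next
    case (Suc k)
    let ?q = "(?f ^^ k) ?s"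
    have q: "I k ?q" "fst ?q i = k" "fst ?q 0 = n" using Suc by auto
    have f: "fst (run c ?q) i = k" "fst (run c ?q) 0 = n" using q prot by (auto simp: run_frame)
    have "I (Suc k) (reg_upd i (Suc k) (run c ?q))"
      using step[OF _ q(2,3,1)] Suc.prems by simp
    then show ?case using f prot by simp
  qed
  then show ?thesis using n by simp
qed

declare run.simps(6) [simp del]

section \<open>The program\<close>

text \<open>
  Registers: 0 holds \<open>n\<close>, 1 holds \<open>n * n\<close>, 2 the current number of separated vertices, 3 the
  current vertex \<open>v\<close>, 4 to 6 and 8 are loop counters, 7 is the offset of a matrix row.  The output
  cells following the matrix hold the set built so far, and the \<open>n\<close> cells after those hold labels
  of the components of \<open>G - v\<close>.
\<close>

definition neq :: "aexp \<Rightarrow> aexp \<Rightarrow> aexp" where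
  "neq a b = Plus (Minus a b) (Minus b a)"

definition out_addr :: "nat \<Rightarrow> aexp" where
  "out_addr x = Plus (Reg 1) (Reg x)"

definition label_addr :: "nat \<Rightarrow> aexp" where
  "label_addr x = Plus (Plus (Reg 1) (Reg 0)) (Reg x)"

definition row_entry :: "nat \<Rightarrow> aexp" where
  "row_entry x = Mem (Plus (Reg 7) (Reg x))"

definition times_n :: "nat \<Rightarrow> nat \<Rightarrow> lcom" where
  "times_n d x = LSeq (LAssign d (Const 0)) (LFor 8 (LAssign d (Plus (Reg d) (Reg x))))"

text \<open>Both labels are saved in registers first, since the loop overwrites the label of the
  vertex in register 4.\<close>

definition relabel_prog :: lcom where
  "relabel_prog =
     LSeq (LAssign 9 (Mem (label_addr 4)))
    (LSeq (LAssign 10 (Mem (label_addr 5)))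
    (LFor 6 (LIf (neq (Mem (label_addr 6)) (Reg 9)) LSkip (LStore (label_addr 6) (Reg 10)))))"

text \<open>Every vertex starts as a class of its own, and each edge of G - v merges two classes.
  One pass over the matrix suffices, since classes never split.\<close>

definition components_prog :: lcom where
  "components_prog =
     LSeq (LFor 4 (LStore (label_addr 4) (Reg 4)))
    (LFor 4 (LSeq (times_n 7 4)
      (LFor 5 (LIf (row_entry 5)
        (LIf (neq (Reg 4) (Reg 3)) (LIf (neq (Reg 5) (Reg 3)) relabel_prog LSkip) LSkip)
        LSkip))))"

definition separated_prog :: lcom where
  "separated_prog =
     LSeq (LAssign 11 (Const 0))
    (LFor 4 (LIf (neq (Reg 4) (Reg 3))
      (LIf (neq (Mem (label_addr 4)) (Mem (Plus (Reg 1) (Reg 0))))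
        (LAssign 11 (Plus (Reg 11) (Const 1))) LSkip)
      LSkip))"

text \<open>Register 12 starts with the output bit of \<open>v\<close> and finally tells whether
  \<open>v\<close> is chosen or locally covered; register 13 is the verdict on a single candidate
  \<open>w\<close>.\<close>

definition covered_prog :: lcom where
  "covered_prog =
     LSeq (times_n 7 3)
    (LSeq (LAssign 12 (Mem (out_addr 3)))
    (LFor 4 (LIf (row_entry 4)
      (LSeq (LAssign 13 (Const 1))
      (LSeq (LFor 5 (LIf (row_entry 5)
          (LIf (neq (Mem (label_addr 5)) (Mem (label_addr 4))) LSkip
            (LIf (Mem (out_addr 5)) LSkip (LAssign 13 (Const 0))))
          LSkip))
        (LIf (Reg 13) (LAssign 12 (Const 1)) LSkip)))
      LSkip)))"

text \<open>The default \<open>v\<close> encodes the lack of a partner; storing it once more in the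
  output is harmless. The cell at n * n + n is the label of the root 0.\<close>

definition partner_prog :: lcom where
  "partner_prog =
     LSeq (LAssign 14 (Reg 3))
    (LFor 4 (LIf (row_entry 4)
      (LIf (neq (Mem (label_addr 4)) (Mem (Plus (Reg 1) (Reg 0)))) LSkip
        (LIf (Mem (out_addr 4)) LSkip (LAssign 14 (Reg 4))))
      LSkip))"

definition process_prog :: lcom where
  "process_prog =
     LSeq components_prog (LSeq separated_prog
      (LIf (neq (Reg 11) (Reg 2)) LSkip
        (LSeq covered_prog (LIf (Reg 12) LSkip
          (LSeq partner_prog
            (LSeq (LStore (out_addr 3) (Const 1)) (LStore (out_addr 14) (Const 1))))))))"

text \<open>In place of sorting, each round of the outer loop goes through all vertices and treats
  those whose number of separated vertices equals register 2.\<close>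

definition main_prog :: lcom where
  "main_prog = LSeq (times_n 1 0) (LFor 2 (LFor 3 process_prog))"

lemmas prog_defs = times_n_def relabel_prog_def components_prog_def separated_prog_def
  covered_prog_def partner_prog_def process_prog_def main_prog_def

lemma aval_simps [simp]:
  "aval (neq a b) s = 0 \<longleftrightarrow> aval a s = aval b s"
  "aval (out_addr x) s = fst s 1 + fst s x"
  "aval (label_addr x) s = fst s 1 + fst s 0 + fst s x"
  "aval (row_entry x) s = snd s (fst s 7 + fst s x)"
  by (auto simp: neq_def out_addr_def label_addr_def row_entry_def)

lemma counters_protected_main: "counters_protected main_prog"
  by (simp add: prog_defs)

lemma written_main: "0 \<notin> written main_prog"
  by (simp add: prog_defs)

section \<open>Correctness of the subroutines\<close>

definition graph_mem :: "nat \<Rightarrow> nat set set \<Rightarrow> state \<Rightarrow> bool" where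
  "graph_mem n E s \<longleftrightarrow> fst s 0 = n \<and> fst s 1 = n * n \<and>
     (\<forall>a<n * n. snd s a = snd (graph_input n E) a)"

definition label :: "nat \<Rightarrow> state \<Rightarrow> nat \<Rightarrow> nat" where
  "label n s x = snd s (n * n + n + x)"

lemma graph_mem_cong:
  assumes "graph_mem n E s" "fst q 0 = fst s 0" "fst q 1 = fst s 1"
    "\<And>a. a < n * n \<Longrightarrow> snd q a = snd s a"
  shows "graph_mem n E q"
  using assms by (simp add: graph_mem_def)

lemma graph_mem_entry:
  assumes "graph_mem n E s" "a < n" "b < n"
  shows "snd s (n * a + b) = 0 \<longleftrightarrow> {a, b} \<notin> E"
proof -
  have "n * a + b < n * Suc a" using assms by simp
  also have "\<dots> \<le> n * n" using assms by (intro mult_le_mono2) simp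
  finally have "n * a + b < n * n" .
  then show ?thesis using assms by (simp add: graph_mem_def graph_input_def)
qed

lemma run_times_n:
  assumes "d \<noteq> 0" "d \<noteq> x" "d \<noteq> 8" "x \<noteq> 8"
  shows "fst (run (times_n d x) s) d = fst s 0 * fst s x" "snd (run (times_n d x) s) = snd s"
proof -
  let ?I = "\<lambda>k q. fst q d = k * fst s x \<and> fst q x = fst s x \<and> snd q = snd s"
  have "?I (fst s 0) (run (LFor 8 (LAssign d (Plus (Reg d) (Reg x)))) (reg_upd d 0 s))"
    by (rule run_LFor_invariant[where I = ?I]) (use assms in auto)
  then show "fst (run (times_n d x) s) d = fst s 0 * fst s x" "snd (run (times_n d x) s) = snd s"
    by (simp_all add: times_n_def)
qed

lemma run_relabel:
  assumes "fst s 0 = n" "fst s 1 = n * n" "fst s 4 < n" "fst s 5 < n"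
  shows "a < n * n + n \<Longrightarrow> snd (run relabel_prog s) a = snd s a"
    and "x < n \<Longrightarrow> label n (run relabel_prog s) x =
      (if label n s x = label n s (fst s 4) then label n s (fst s 5) else label n s x)"
proof -
  define la lb where "la = label n s (fst s 4)" and "lb = label n s (fst s 5)"
  let ?I = "\<lambda>k q. fst q 1 = n * n \<and> fst q 9 = la \<and> fst q 10 = lb \<and>
    (\<forall>a<n * n + n. snd q a = snd s a) \<and>
    (\<forall>x<n. label n q x = (if x < k \<and> label n s x = la then lb else label n s x))"
  have "?I n (run (LFor 6 (LIf (neq (Mem (label_addr 6)) (Reg 9)) LSkip
      (LStore (label_addr 6) (Reg 10)))) (reg_upd 10 lb (reg_upd 9 la s)))"
    by (rule run_LFor_invariant[where I = ?I]) (use assms in \<open>auto simp: label_def less_Suc_eq\<close>)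
  moreover have "run relabel_prog s = run (LFor 6 (LIf (neq (Mem (label_addr 6)) (Reg 9)) LSkip
      (LStore (label_addr 6) (Reg 10)))) (reg_upd 10 lb (reg_upd 9 la s))"
    using assms by (simp add: relabel_prog_def la_def lb_def label_def)
  ultimately show "a < n * n + n \<Longrightarrow> snd (run relabel_prog s) a = snd s a"
    and "x < n \<Longrightarrow> label n (run relabel_prog s) x =
      (if label n s x = label n s (fst s 4) then label n s (fst s 5) else label n s x)"
    by (simp_all add: la_def lb_def)
qed

text \<open>Labels are always sound for the components of G - v, and complete for the matrix
  positions \<open>Z\<close> read so far. The initial state \<open>s\<close> records the matrix and
  the output, which stay intact.\<close>

definition merged :: "nat \<Rightarrow> nat set set \<Rightarrow> nat \<Rightarrow> state \<Rightarrow> (nat \<times> nat) set \<Rightarrow> state \<Rightarrow> bool" where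
  "merged n E v s Z q \<longleftrightarrow> fst q 1 = n * n \<and> fst q 3 = v \<and>
     (\<forall>a<n * n + n. snd q a = snd s a) \<and>
     (\<forall>x<n. \<forall>y<n. label n q x = label n q y \<longrightarrow> (x, y) \<in> (adj_minus E v)\<^sup>*) \<and>
     (\<forall>x<n. \<forall>y<n. (x, y) \<in> Z \<inter> adj_minus E v \<longrightarrow> label n q x = label n q y)"

lemma merged_reg_upd: "x \<noteq> 1 \<Longrightarrow> x \<noteq> 3 \<Longrightarrow> merged n E v s Z (reg_upd x k q) = merged n E v s Z q"
  by (simp add: merged_def label_def)

lemma merged_relabel:
  assumes m: "merged n E v s Z q" and "fst q 0 = n" "fst q 4 < n" "fst q 5 < n"
    and adj: "(fst q 4, fst q 5) \<in> adj_minus E v"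
  shows "merged n E v s (insert (fst q 4, fst q 5) Z) (run relabel_prog q)"
proof -
  let ?a = "fst q 4" and ?b = "fst q 5" and ?q = "run relabel_prog q"
  have q1: "fst q 1 = n * n" using m by (simp add: merged_def)
  note rel = run_relabel[OF assms(2) q1 assms(3,4)]
  have fr: "fst ?q 1 = fst q 1" "fst ?q 3 = fst q 3"
    by (simp_all add: run_frame relabel_prog_def del: run.simps)
  have snd_ok: "(x, y) \<in> (adj_minus E v)\<^sup>*"
    if "x < n" "y < n" "label n q x = label n q y" for x y
    using m that by (simp add: merged_def)
  have ba: "(?b, ?a) \<in> (adj_minus E v)\<^sup>*" "(?a, ?b) \<in> (adj_minus E v)\<^sup>*"
    using adj_minus_rtrancl_sym[OF r_into_rtrancl[OF adj]] r_into_rtrancl[OF adj] by simp_all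
  have "(x, y) \<in> (adj_minus E v)\<^sup>*"
    if xy: "x < n" "y < n" "label n ?q x = label n ?q y" for x y
  proof (cases "label n q x = label n q y")
    case False
    \<comment> \<open>Labels that become equal belong to the two classes just merged, which the edge
      between \<open>?a\<close> and \<open>?b\<close> connects.\<close>
    then consider "label n q x = label n q ?a" "label n q y = label n q ?b"
      | "label n q x = label n q ?b" "label n q y = label n q ?a"
      using xy rel(2) by (auto split: if_splits)
    then show ?thesis
    proof cases
      case 1
      then have "(x, ?a) \<in> (adj_minus E v)\<^sup>*" "(?b, y) \<in> (adj_minus E v)\<^sup>*"
        using snd_ok xy assms(3,4) by simp_all
      then show ?thesis using ba by (meson rtrancl_trans)
    next
      case 2
      then have "(x, ?b) \<in> (adj_minus E v)\<^sup>*" "(?a, y) \<in> (adj_minus E v)\<^sup>*"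
        using snd_ok xy assms(3,4) by simp_all
      then show ?thesis using ba by (meson rtrancl_trans)
    qed
  qed (use snd_ok xy in simp)
  then show ?thesis
    using m fr rel assms(3,4) unfolding merged_def by auto
qed

lemma run_components:
  assumes g: "graph_mem n E s" and sg: "simple_graph {..<n} E" and v: "fst s 3 = v"
  shows "a < n * n + n \<Longrightarrow> snd (run components_prog s) a = snd s a"
    and "x < n \<Longrightarrow> y < n \<Longrightarrow> label n (run components_prog s) x = label n (run components_prog s) y
      \<longleftrightarrow> (x, y) \<in> (adj_minus E v)\<^sup>*"
proof -
  have s0: "fst s 0 = n" and s1: "fst s 1 = n * n" using g by (auto simp: graph_mem_def)
  define q where "q = run (LFor 4 (LStore (label_addr 4) (Reg 4))) s"
  have "fst q 1 = n * n \<and> (\<forall>a<n * n + n. snd q a = snd s a) \<and> (\<forall>x<n. x < n \<longrightarrow> label n q x = x)"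
    unfolding q_def
    by (rule run_LFor_invariant[where I = "\<lambda>k q. fst q 1 = n * n \<and>
        (\<forall>a<n * n + n. snd q a = snd s a) \<and> (\<forall>x<n. x < k \<longrightarrow> label n q x = x)"])
      (use s0 s1 in \<open>auto simp: label_def less_Suc_eq\<close>)
  moreover have q0: "fst q 0 = n" "fst q 3 = v"
    using s0 v by (simp_all add: q_def run_frame del: run.simps)
  ultimately have init: "merged n E v s {} q" by (auto simp: merged_def)
  let ?inner = "LIf (row_entry 5)
        (LIf (neq (Reg 4) (Reg 3)) (LIf (neq (Reg 5) (Reg 3)) relabel_prog LSkip) LSkip) LSkip"
  have inner: "merged n E v s {(x, y). x < k \<or> x = k \<and> y < n} (run (LFor 5 ?inner) r)"
    if r: "fst r 0 = n" "fst r 4 = k" "fst r 7 = n * k" "k < n" "merged n E v s {(x, y). x < k} r"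
    for r k
  proof -
    let ?Z = "\<lambda>j. {(x, y). x < k \<or> x = k \<and> y < j}"
    let ?I = "\<lambda>j r. fst r 4 = k \<and> fst r 7 = n * k \<and> merged n E v s (?Z j) r"
    have "?I n (run (LFor 5 ?inner) r)"
    proof (rule run_LFor_invariant[where I = ?I])
      fix j p
      assume j: "j < n" and p: "fst p 5 = j" "fst p 0 = n" "?I j p"
      have Z: "?Z (Suc j) = insert (k, j) (?Z j)" by (auto simp: less_Suc_eq)
      have "graph_mem n E p"
        using g p by (auto simp: graph_mem_def merged_def)
      then have e: "snd p (n * k + j) = 0 \<longleftrightarrow> {k, j} \<notin> E"
        using r(4) j by (rule graph_mem_entry)
      have p3: "fst p 3 = v" using p by (simp add: merged_def)
      \<comment> \<open>At a position that is no edge of G - v the program does nothing, and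
        enlarging \<open>Z\<close> by it demands nothing.\<close>
      have "merged n E v s (?Z (Suc j)) (run ?inner p)"
      proof (cases "(k, j) \<in> adj_minus E v")
        case True
        then have "run ?inner p = run relabel_prog p"
          using p p3 e by (auto simp: adj_minus_def)
        then show ?thesis
          using merged_relabel[of n E v s "?Z j" p] p r(4) j True by (simp add: Z)
      next
        case False
        then have "run ?inner p = p"
          using p p3 e by (auto simp: adj_minus_def)
        then show ?thesis using p False by (auto simp: merged_def Z)
      qed
      moreover have "fst (run ?inner p) 4 = k" "fst (run ?inner p) 7 = n * k"
        using p by (simp_all add: run_frame relabel_prog_def del: run.simps)
      ultimately show "?I (Suc j) (reg_upd 5 (Suc j) (run ?inner p))"
        by (simp add: merged_reg_upd del: run.simps)
    qed (use r in \<open>auto simp: merged_reg_upd relabel_prog_def\<close>)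
    then show ?thesis by blast
  qed
  have "merged n E v s {(x, y). x < n} (run (LFor 4 (LSeq (times_n 7 4) (LFor 5 ?inner))) q)"
  proof (rule run_LFor_invariant[where I = "\<lambda>k. merged n E v s {(x, y). x < k}"])
    fix k r
    assume k: "k < n" and r: "fst r 4 = k" "fst r 0 = n" "merged n E v s {(x, y). x < k} r"
    let ?r = "run (times_n 7 4) r"
    have fr: "fst ?r 0 = n" "fst ?r 4 = k" "fst ?r 1 = fst r 1" "fst ?r 3 = fst r 3"
      using r by (simp_all add: run_frame times_n_def del: run.simps)
    have row: "fst ?r 7 = n * k" "snd ?r = snd r"
      using run_times_n[of 7 4 r] r by simp_all
    have "merged n E v s {(x, y). x < k} ?r"
      using r(3) fr row by (simp add: merged_def label_def)
    from inner[OF fr(1,2) row(1) k this]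
    have "merged n E v s {(x, y). x < k \<or> x = k \<and> y < n} (run (LFor 5 ?inner) ?r)" .
    then have "merged n E v s {(x, y). x < Suc k} (run (LFor 5 ?inner) ?r)"
      unfolding merged_def by (auto simp: less_Suc_eq simp del: run.simps)
    then show "merged n E v s {(x, y). x < Suc k}
        (reg_upd 4 (Suc k) (run (LSeq (times_n 7 4) (LFor 5 ?inner)) r))"
      by (simp add: merged_reg_upd)
  qed (use init q0 in \<open>auto simp: merged_reg_upd times_n_def relabel_prog_def\<close>)
  then have fin: "merged n E v s {(x, y). x < n} (run components_prog s)"
    by (simp add: components_prog_def q_def)
  then show "a < n * n + n \<Longrightarrow> snd (run components_prog s) a = snd s a"
    by (simp add: merged_def)
  assume xy: "x < n" "y < n"
  show "label n (run components_prog s) x = label n (run components_prog s) y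
      \<longleftrightarrow> (x, y) \<in> (adj_minus E v)\<^sup>*"
  proof
    \<comment> \<open>Completeness passes along the edges of a walk. The bound is carried along
      because labels are controlled only on the vertices.\<close>
    assume "(x, y) \<in> (adj_minus E v)\<^sup>*"
    then have "label n (run components_prog s) x = label n (run components_prog s) y \<and> y < n"
    proof (induction rule: rtrancl_induct)
      case (step y z)
      then have "z < n" using simple_graph_edgeD[OF sg, of y z] by (auto simp: adj_minus_def)
      then have "label n (run components_prog s) y = label n (run components_prog s) z"
        using fin step by (auto simp: merged_def)
      then show ?case using step \<open>z < n\<close> by simp
    qed (use xy in simp)
    then show "label n (run components_prog s) x = label n (run components_prog s) y" by simp
  qed (use fin xy in \<open>auto simp: merged_def\<close>)
qed

lemma run_separated:
  assumes "fst s 0 = n" "fst s 1 = n * n"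
  shows "fst (run separated_prog s) 11 = card {x. x < n \<and> x \<noteq> fst s 3 \<and> label n s x \<noteq> label n s 0}"
    and "snd (run separated_prog s) = snd s"
proof -
  define A where "A k = {x. x < k \<and> x \<noteq> fst s 3 \<and> label n s x \<noteq> label n s 0}" for k
  let ?I = "\<lambda>k (q :: state). fst q 1 = n * n \<and> fst q 3 = fst s 3 \<and> snd q = snd s \<and>
    fst q 11 = card (A k)"
  have A: "A 0 = {}" "finite (A k)" "k \<notin> A k"
    "A (Suc k) = (if k \<noteq> fst s 3 \<and> label n s k \<noteq> label n s 0 then insert k (A k) else A k)" for k
    by (auto simp: A_def less_Suc_eq)
  have "?I n (run separated_prog s)"
    unfolding separated_prog_def run.simps(4)
    by (rule run_LFor_invariant[where I = ?I]) (use assms in \<open>auto simp: A label_def\<close>)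
  then show "fst (run separated_prog s) 11 =
      card {x. x < n \<and> x \<noteq> fst s 3 \<and> label n s x \<noteq> label n s 0}"
    and "snd (run separated_prog s) = snd s" by (simp_all add: A_def)
qed

text \<open>The last conclusion hands the matrix row of \<open>v\<close> over to
  \<open>partner_prog\<close>, which does not compute it again.\<close>

lemma run_covered:
  assumes g: "graph_mem n E s" and v: "fst s 3 = v" "v < n"
  shows "fst (run covered_prog s) 12 = 0 \<longleftrightarrow> \<not> (v \<in> vertex_set_output n s \<or>
      (\<exists>w<n. {v, w} \<in> E \<and> (\<forall>u<n. {v, u} \<in> E \<and> label n s u = label n s w \<longrightarrow>
        u \<in> vertex_set_output n s)))"
    and "snd (run covered_prog s) = snd s"
    and "fst (run covered_prog s) 7 = n * v"
proof -
  let ?S = "vertex_set_output n s"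
  let ?P = "\<lambda>w u. {v, u} \<in> E \<and> label n s u = label n s w \<and> u \<notin> ?S"
  let ?in = "LIf (row_entry 5)
          (LIf (neq (Mem (label_addr 5)) (Mem (label_addr 4))) LSkip
            (LIf (Mem (out_addr 5)) LSkip (LAssign 13 (Const 0))))
          LSkip"
  let ?out = "LIf (row_entry 4)
      (LSeq (LAssign 13 (Const 1))
      (LSeq (LFor 5 ?in) (LIf (Reg 13) (LAssign 12 (Const 1)) LSkip))) LSkip"
  define C where "C q \<longleftrightarrow> fst q 0 = n \<and> fst q 1 = n * n \<and> fst q 7 = n * v \<and> snd q = snd s" for q :: state
  have ent: "snd s (n * v + b) = 0 \<longleftrightarrow> {v, b} \<notin> E" if "b < n" for b
    using graph_mem_entry[OF g v(2) that] .
  have s01: "fst s 0 = n" "fst s 1 = n * n" using g by (auto simp: graph_mem_def)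
  have inner: "C (run (LFor 5 ?in) q) \<and> fst (run (LFor 5 ?in) q) 12 = fst q 12 \<and>
      (fst (run (LFor 5 ?in) q) 13 = 0 \<longleftrightarrow> (\<exists>u<n. ?P w u))"
    if q: "C q" "fst q 4 = w" "w < n" "fst q 13 = 1" for q w
  proof -
    let ?I = "\<lambda>k r. C r \<and> fst r 12 = fst q 12 \<and> fst r 4 = w \<and> (fst r 13 = 0 \<longleftrightarrow> (\<exists>u<k. ?P w u))"
    have "?I n (run (LFor 5 ?in) q)"
    proof (rule run_LFor_invariant[where I = ?I])
      fix k r
      assume k: "k < n" and r: "fst r 5 = k" "fst r 0 = n" "?I k r"
      show "?I (Suc k) (reg_upd 5 (Suc k) (run ?in r))"
        using k r ent[OF k]
        by (auto simp: C_def label_def vertex_set_output_def less_Suc_eq)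
    qed (use q in \<open>auto simp: C_def\<close>)
    then show ?thesis by blast
  qed
  define q where "q = reg_upd 12 (snd s (n * n + v)) (run (times_n 7 3) s)"
  have fr: "fst (run (times_n 7 3) s) 0 = n" "fst (run (times_n 7 3) s) 1 = n * n"
    "fst (run (times_n 7 3) s) 3 = v"
    using s01 v by (simp_all add: run_frame times_n_def del: run.simps)
  have row: "fst (run (times_n 7 3) s) 7 = n * v" "snd (run (times_n 7 3) s) = snd s"
    using run_times_n[of 7 3 s] s01 v by simp_all
  have "C q" using fr row by (simp add: C_def q_def)
  let ?J = "\<lambda>k q. C q \<and> (fst q 12 = 0 \<longleftrightarrow>
      \<not> (v \<in> ?S \<or> (\<exists>w<k. {v, w} \<in> E \<and> \<not> (\<exists>u<n. ?P w u))))"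
  have "?J n (run (LFor 4 ?out) q)"
  proof (rule run_LFor_invariant[where I = ?J])
    fix k r
    assume k: "k < n" and r: "fst r 4 = k" "fst r 0 = n" "?J k r"
    have "C (reg_upd 13 1 r)" using r by (simp add: C_def)
    then have in': "C (run (LFor 5 ?in) (reg_upd 13 1 r))"
      "fst (run (LFor 5 ?in) (reg_upd 13 1 r)) 12 = fst r 12"
      "fst (run (LFor 5 ?in) (reg_upd 13 1 r)) 13 = 0 \<longleftrightarrow> (\<exists>u<n. ?P k u)"
      using inner[of "reg_upd 13 1 r" k] r k by (simp_all del: run.simps)
    have e: "aval (row_entry 4) r = 0 \<longleftrightarrow> {v, k} \<notin> E"
      using r ent[OF k] by (simp add: C_def)
    show "?J (Suc k) (reg_upd 4 (Suc k) (run ?out r))"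
    proof (cases "{v, k} \<in> E")
      case False
      then have "run ?out r = r" using e by simp
      then show ?thesis using r False by (auto simp: C_def less_Suc_eq)
    next
      case True
      define q' where "q' = run (LFor 5 ?in) (reg_upd 13 1 r)"
      have "run ?out r = (if \<exists>u<n. ?P k u then q' else reg_upd 12 1 q')"
        using e True in'(3) by (auto simp: q'_def)
      moreover have "C q'" "fst q' 12 = fst r 12" using in' by (simp_all add: q'_def)
      moreover have "(\<exists>w<Suc k. {v, w} \<in> E \<and> \<not> (\<exists>u<n. ?P w u)) \<longleftrightarrow>
          (\<exists>w<k. {v, w} \<in> E \<and> \<not> (\<exists>u<n. ?P w u)) \<or> \<not> (\<exists>u<n. ?P k u)"
        using True less_Suc_eq by auto
      ultimately show ?thesis
        using r by (cases "\<exists>u<n. ?P k u") (simp_all only: C_def reg_upd_simps, auto)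
    qed
  next
    show "?J 0 (reg_upd 4 0 q)"
      using \<open>C q\<close> v by (simp add: C_def q_def vertex_set_output_def)
  qed (use \<open>C q\<close> in \<open>auto simp: C_def\<close>)
  moreover have "run covered_prog s = run (LFor 4 ?out) q"
    using fr row by (simp add: covered_prog_def q_def)
  ultimately have fin: "?J n (run covered_prog s)" by (simp only:)
  then show "snd (run covered_prog s) = snd s" "fst (run covered_prog s) 7 = n * v"
    by (simp_all add: C_def)
  show "fst (run covered_prog s) 12 = 0 \<longleftrightarrow> \<not> (v \<in> ?S \<or>
      (\<exists>w<n. {v, w} \<in> E \<and> (\<forall>u<n. {v, u} \<in> E \<and> label n s u = label n s w \<longrightarrow> u \<in> ?S)))"
    using fin by blast
qed

lemma run_partner:
  assumes g: "graph_mem n E s" and v: "fst s 3 = v" "v < n" and row: "fst s 7 = n * v"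
  defines "Q \<equiv> \<lambda>x. x < n \<and> {v, x} \<in> E \<and> label n s x = label n s 0 \<and> x \<notin> vertex_set_output n s"
  shows "Q (fst (run partner_prog s) 14) \<or> fst (run partner_prog s) 14 = v \<and> \<not> (\<exists>x. Q x)"
    and "snd (run partner_prog s) = snd s"
proof -
  have s01: "fst s 0 = n" "fst s 1 = n * n" using g by (auto simp: graph_mem_def)
  have ent: "snd s (n * v + b) = 0 \<longleftrightarrow> {v, b} \<notin> E" if "b < n" for b
    using graph_mem_entry[OF g v(2) that] .
  let ?I = "\<lambda>k (q :: state). fst q 1 = n * n \<and> fst q 7 = n * v \<and> snd q = snd s \<and>
    (Q (fst q 14) \<or> fst q 14 = v \<and> \<not> (\<exists>x<k. Q x))"
  have "?I n (run partner_prog s)"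
    unfolding partner_prog_def run.simps(4)
  proof (rule run_LFor_invariant[where I = ?I])
    fix k q
    assume k: "k < n" and q: "fst q 4 = k" "fst q 0 = n" "?I k q"
    show "?I (Suc k) (reg_upd 4 (Suc k) (run (LIf (row_entry 4)
      (LIf (neq (Mem (label_addr 4)) (Mem (Plus (Reg 1) (Reg 0)))) LSkip
        (LIf (Mem (out_addr 4)) LSkip (LAssign 14 (Reg 4))))
      LSkip) q))"
      using k q ent[OF k]
      by (auto simp: Q_def label_def vertex_set_output_def less_Suc_eq)
  qed (use s01 v row in auto)
  then show "Q (fst (run partner_prog s) 14) \<or> fst (run partner_prog s) 14 = v \<and> \<not> (\<exists>x. Q x)"
    and "snd (run partner_prog s) = snd s" by (auto simp: Q_def)
qed

text \<open>Pairs of separated size and vertex are compared lexicographically with the two loop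
  counters, so one step adds \<open>v\<close> or nothing.\<close>

definition processed :: "nat \<Rightarrow> nat set set \<Rightarrow> nat \<Rightarrow> nat \<Rightarrow> nat set" where
  "processed n E k v = {x. x < n \<and> (card (separated {..<n} E 0 x) < k \<or>
     card (separated {..<n} E 0 x) = k \<and> x < v)}"

lemma run_process:
  assumes g: "graph_mem n E s" and conn: "connected_graph {..<n} E"
    and k: "fst s 2 = k" and v: "fst s 3 = v" "v < n"
    and inv: "greedy_invariant {..<n} E 0 (processed n E k v) (vertex_set_output n s)"
  shows "graph_mem n E (run process_prog s)"
    and "greedy_invariant {..<n} E 0 (processed n E k (Suc v))
      (vertex_set_output n (run process_prog s))"
proof -
  let ?V = "{..<n}" and ?S = "vertex_set_output n s"
  let ?P = "processed n E k v"
  have sg: "simple_graph ?V E" using conn by (rule connected_graph_simple)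
  have n0: "0 < n" using v by simp
  define s1 where "s1 = run components_prog s"
  have m1: "\<And>a. a < n * n + n \<Longrightarrow> snd s1 a = snd s a"
    and lab: "\<And>x y. x < n \<Longrightarrow> y < n \<Longrightarrow> label n s1 x = label n s1 y \<longleftrightarrow> (x, y) \<in> (adj_minus E v)\<^sup>*"
    unfolding s1_def using run_components[OF g sg v(1)] by blast+
  have f1: "fst s1 0 = fst s 0" "fst s1 1 = fst s 1" "fst s1 2 = k" "fst s1 3 = v"
    unfolding s1_def using k v
    by (simp_all add: run_frame components_prog_def relabel_prog_def times_n_def del: run.simps)
  have g1: "graph_mem n E s1" using g f1(1,2) m1 by (rule graph_mem_cong) simp_all
  have out1: "vertex_set_output n s1 = ?S" using m1 by (auto simp: vertex_set_output_def)
  define s2 where "s2 = run separated_prog s1"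
  have m2: "snd s2 = snd s1"
    and r11: "fst s2 11 = card {x. x < n \<and> x \<noteq> v \<and> label n s1 x \<noteq> label n s1 0}"
    unfolding s2_def using run_separated[of s1 n] g1 f1 by (simp_all add: graph_mem_def)
  have lab0: "label n s1 y = label n s1 0 \<longleftrightarrow> (0, y) \<in> (adj_minus E v)\<^sup>*" if "y < n" for y
    using lab[OF n0 that] by auto
  have "{x. x < n \<and> x \<noteq> v \<and> label n s1 x \<noteq> label n s1 0} = separated ?V E 0 v"
    using lab0 by (auto simp: separated_def)
  then have r11: "fst s2 11 = card (separated ?V E 0 v)" using r11 by simp
  have f2: "fst s2 0 = fst s1 0" "fst s2 1 = fst s1 1" "fst s2 2 = k" "fst s2 3 = v"
    unfolding s2_def using f1 by (simp_all add: run_frame separated_prog_def del: run.simps)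
  have g2: "graph_mem n E s2" using g1 f2(1,2) by (rule graph_mem_cong) (simp add: m2)
  have out2: "vertex_set_output n s2 = ?S" using out1 m2 by (simp add: vertex_set_output_def)
  have lab2: "label n s2 x = label n s1 x" for x using m2 by (simp add: label_def)
  let ?rest = "LSeq covered_prog (LIf (Reg 12) LSkip (LSeq partner_prog
            (LSeq (LStore (out_addr 3) (Const 1)) (LStore (out_addr 14) (Const 1)))))"
  have run1: "run process_prog s = (if card (separated ?V E 0 v) = k then run ?rest s2 else s2)"
    using r11 f2 by (simp add: process_prog_def s1_def s2_def)
  have "graph_mem n E (run process_prog s) \<and> greedy_invariant ?V E 0 (processed n E k (Suc v))
      (vertex_set_output n (run process_prog s))"
  proof (cases "card (separated ?V E 0 v) = k")
    case False
    then have "processed n E k (Suc v) = ?P" by (auto simp: processed_def less_Suc_eq)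
    then show ?thesis using False run1 g2 out2 inv by simp
  next
    case True
    then have P': "processed n E k (Suc v) = insert v ?P"
      using v by (auto simp: processed_def less_Suc_eq)
    define s3 where "s3 = run covered_prog s2"
    note cov = run_covered[OF g2 f2(4) v(2), folded s3_def]
    have f3: "fst s3 0 = fst s2 0" "fst s3 1 = fst s2 1" "fst s3 3 = v"
      unfolding s3_def using f2
      by (simp_all add: run_frame covered_prog_def times_n_def del: run.simps)
    have g3: "graph_mem n E s3" using g2 f3(1,2) by (rule graph_mem_cong) (simp add: cov(2))
    have out3: "vertex_set_output n s3 = ?S" using out2 cov(2) by (simp add: vertex_set_output_def)
    have lab3: "label n s3 x = label n s1 x" for x using lab2 cov(2) by (simp add: label_def)
    \<comment> \<open>The program looks only at vertices below \<open>n\<close>, while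
      \<open>locally_covered\<close> quantifies without bound; neighbours bridge the gap.\<close>
    have nb: "u < n" if "{v, u} \<in> E" for u using simple_graph_edgeD[OF sg that] by simp
    have "locally_covered E ?S v \<longleftrightarrow> (\<exists>w<n. {v, w} \<in> E \<and>
        (\<forall>u<n. {v, u} \<in> E \<and> label n s2 u = label n s2 w \<longrightarrow> u \<in> ?S))"
      unfolding locally_covered_def lab2 using lab nb by blast
    then have r12: "fst s3 12 = 0 \<longleftrightarrow> \<not> (v \<in> ?S \<or> locally_covered E ?S v)"
      using cov(1) out2 by simp
    show ?thesis
    proof (cases "v \<in> ?S \<or> locally_covered E ?S v")
      case covd: True
      then have "run process_prog s = s3" using run1 True r12 by (simp add: s3_def)
      then show ?thesis using g3 out3 P' greedy_invariant_skip[OF inv covd] by simp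
    next
      case False
      define s4 where "s4 = run partner_prog s3"
      define x where "x = fst s4 14"
      note par = run_partner[OF g3 f3(3) v(2) cov(3), folded s4_def, unfolded lab3 out3, folded x_def]
      have f4: "fst s4 0 = n" "fst s4 1 = n * n" "fst s4 3 = v"
        unfolding s4_def using f3 g3
        by (simp_all add: run_frame partner_prog_def graph_mem_def del: run.simps)
      have fin: "run process_prog s = mem_upd (n * n + x) 1 (mem_upd (n * n + v) 1 s4)"
        using run1 True r12 False f4 by (simp add: s3_def s4_def x_def)
      have "x < n" using par(1) v by blast
      have out4: "vertex_set_output n (run process_prog s) = insert x (insert v ?S)"
        using par(2) out3 v \<open>x < n\<close> by (auto simp: fin vertex_set_output_def)
      have g4: "graph_mem n E (run process_prog s)"
        using g3 by (rule graph_mem_cong) (use f4 g3 par(2) in \<open>auto simp: fin graph_mem_def\<close>)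
      \<comment> \<open>By \<open>separated_psubset\<close>, members of D(d) have smaller counts
        than \<open>d\<close> and belong to earlier rounds.\<close>
      have closed: "separated ?V E 0 d \<subseteq> ?P" if "d \<in> ?P" for d
      proof
        fix c assume c: "c \<in> separated ?V E 0 d"
        have "card (separated ?V E 0 c) < card (separated ?V E 0 d)"
          using separated_psubset[OF conn _ c] n0
          by (intro psubset_card_mono) (auto simp: separated_def)
        then show "c \<in> ?P" using c that by (auto simp: processed_def separated_def)
      qed
      have "greedy_invariant ?V E 0 (insert v ?P) (insert x (insert v ?S))"
      proof (rule greedy_invariant_add[OF inv conn])
        show "x = v \<or> {v, x} \<in> E \<and> (0, x) \<in> (adj_minus E v)\<^sup>* \<and> x \<notin> ?S"
          using par(1) lab0 by blast
        show "\<not> (\<exists>y. {v, y} \<in> E \<and> (0, y) \<in> (adj_minus E v)\<^sup>* \<and> y \<notin> ?S)" if "x = v"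
        proof -
          \<comment> \<open>No vertex is adjacent to itself, so \<open>x = v\<close> leaves only the
            case that the search found nothing.\<close>
          have "{v, x} \<notin> E" using that simple_graph_edgeD(3)[OF sg, of v x] by blast
          then show ?thesis using par(1) lab0 nb by blast
        qed
      qed (use False True v n0 closed in \<open>auto simp: processed_def\<close>)
      then show ?thesis using g4 out4 P' by simp
    qed
  qed
  then show "graph_mem n E (run process_prog s)"
    and "greedy_invariant ?V E 0 (processed n E k (Suc v))
      (vertex_set_output n (run process_prog s))" by blast+
qed

section \<open>The nested loops as a whole\<close>

lemma run_main:
  assumes conn: "connected_graph {..<n} E"
  shows "greedy_invariant {..<n} E 0 {..<n} (vertex_set_output n (run main_prog (graph_input n E)))"
proof -
  let ?s = "graph_input n E" and ?V = "{..<n}"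
  have n0: "0 < n" using conn by (auto simp: connected_graph_def)
  let ?q = "run (times_n 1 0) ?s"
  have q: "fst ?q 1 = n * n" "snd ?q = snd ?s"
    using run_times_n[of 1 0 ?s] by (simp_all add: graph_input_def)
  have q0: "fst ?q 0 = n" by (simp add: run_frame times_n_def graph_input_def del: run.simps)
  have gq: "graph_mem n E ?q" using q q0 by (simp add: graph_mem_def)
  have "vertex_set_output n ?q = {}" using q by (auto simp: vertex_set_output_def graph_input_def)
  moreover have "processed n E 0 0 = {}" by (auto simp: processed_def)
  ultimately have init: "greedy_invariant ?V E 0 (processed n E 0 0) (vertex_set_output n ?q)"
    using greedy_invariant_empty by simp
  define I where "I k v q \<longleftrightarrow> graph_mem n E q \<and>
    greedy_invariant ?V E 0 (processed n E k v) (vertex_set_output n q)" for k v q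
  have I_upd: "I k v (reg_upd x j q) = I k v q" if "x \<noteq> 0" "x \<noteq> 1" for k v x j q
    using that by (simp add: I_def graph_mem_def vertex_set_output_def)
  have w: "written process_prog = {4, 5, 6, 7, 8, 9, 10, 11, 12, 13, 14}"
    by (auto simp: prog_defs)
  have inner: "I k n (run (LFor 3 process_prog) q)"
    if "I k 0 q" "fst q 0 = n" "fst q 2 = k" for k q
  proof -
    have "I k n (run (LFor 3 process_prog) q) \<and> fst (run (LFor 3 process_prog) q) 2 = k"
    proof (rule run_LFor_invariant[where I = "\<lambda>v q. I k v q \<and> fst q 2 = k"])
      fix v r assume "v < n" "fst r 3 = v" "fst r 0 = n" "I k v r \<and> fst r 2 = k"
      then have "I k (Suc v) (run process_prog r)" "fst (run process_prog r) 2 = k"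
        using run_process[of n E r k v] conn by (auto simp: I_def run_frame w)
      then show "I k (Suc v) (reg_upd 3 (Suc v) (run process_prog r)) \<and>
          fst (reg_upd 3 (Suc v) (run process_prog r)) 2 = k"
        by (simp add: I_upd)
    qed (use that w in \<open>auto simp: I_upd\<close>)
    then show ?thesis ..
  qed
  have "I n 0 (run (LFor 2 (LFor 3 process_prog)) ?q)"
  proof (rule run_LFor_invariant[where I = "\<lambda>k. I k 0"])
    fix k r assume "fst r 2 = k" "fst r 0 = n" "I k 0 r"
    then have "I k n (run (LFor 3 process_prog) r)" using inner by blast
    \<comment> \<open>The end of one round is, lexicographically, the start of the next.\<close>
    moreover have "processed n E k n = processed n E (Suc k) 0"
      by (auto simp: processed_def)
    ultimately have "I (Suc k) 0 (run (LFor 3 process_prog) r)" by (simp add: I_def)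
    then show "I (Suc k) 0 (reg_upd 2 (Suc k) (run (LFor 3 process_prog) r))"
      by (simp add: I_upd del: run.simps)
  qed (use init gq q0 w in \<open>auto simp: I_def I_upd graph_mem_def vertex_set_output_def\<close>)
  \<comment> \<open>D(x) omits \<open>x\<close>, so all counts are below \<open>n\<close> and the
    \<open>n\<close> rounds reach every vertex.\<close>
  moreover have "processed n E n 0 = ?V"
  proof -
    have "card (separated ?V E 0 x) < n" if "x < n" for x
    proof -
      have "separated ?V E 0 x \<subset> ?V" using that by (auto simp: separated_def)
      then have "card (separated ?V E 0 x) < card ?V" by (intro psubset_card_mono) simp_all
      then show ?thesis by simp
    qed
    then show ?thesis by (auto simp: processed_def)
  qed
  ultimately show ?thesis by (simp add: I_def main_prog_def)
qed

theorem theorem17: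
  shows "\<exists>(c :: com) (p :: nat poly). \<forall>(n :: nat) (E :: nat set set).
    connected_graph {..<n} E \<longrightarrow>
    (\<exists>t s. exec c (graph_input n E) t s \<and> t \<le> poly p n \<and>
       simultaneous_dominating_set {..<n} E (vertex_set_output n s) \<and>
       card (vertex_set_output n s) \<le> 2 * simultaneous_domination_number {..<n} E)"
proof (intro exI[of _ "compile main_prog"] exI[of _ "time_poly main_prog"] allI impI)
  fix n :: nat and E :: "nat set set"
  assume conn: "connected_graph {..<n} E"
  let ?s = "run main_prog (graph_input n E)"
  obtain t where t: "exec (compile main_prog) (graph_input n E) t ?s"
      "t \<le> poly (time_poly main_prog) (fst (graph_input n E) 0)"
    using compile_exec[OF counters_protected_main written_main] by blast
  have "fst (graph_input n E) 0 = n" by (simp add: graph_input_def)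
  then show "\<exists>t s. exec (compile main_prog) (graph_input n E) t s \<and>
      t \<le> poly (time_poly main_prog) n \<and>
      simultaneous_dominating_set {..<n} E (vertex_set_output n s) \<and>
      card (vertex_set_output n s) \<le> 2 * simultaneous_domination_number {..<n} E"
    using t greedy_invariant_final[OF run_main[OF conn] conn] by metis
qed

end
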